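(* Let $1\le n<\omega$. Let $G=(V,E)$ be a (possibly infinite) undirected graph with multiple edges allowed and no loops, let $\mu(G)$ be the supremum of the edge multiplicities of $G$, and let $X\subseteq V$ be such that $d_G(x)\ge n+\mu(G)$ for every $x\in X$. Then $E$ has an $n$-good coloring over $X$, i.e. there is a map $c:E\to n$ such that for every $x\in X$ the edges incident to $x$ receive all $n$ colors.
   Context: $d_G(x)$ is the degree of $x$, counting multiple edges with multiplicity (a cardinal); $n+\mu(G)$ is cardinal addition. *)

theory Defs
  imports Main "HOL-Library.FuncSet"
begin

unbundle cardinal_syntax

text \<open>
  Undirected multigraphs: each edge is an object of its own, and \<open>ends e\<close> is its set of two
  (distinct) end vertices.  The sets of vertices and of edges may be infinite.
\<close>

locale multigraph =
  fixes V :: "'v set" and E :: "'e set" and ends :: "'e \<Rightarrow> 'v set"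
  assumes ends_subset: "e \<in> E \<Longrightarrow> ends e \<subseteq> V"
    and card_ends: "e \<in> E \<Longrightarrow> card (ends e) = 2"

definition incident_edges :: "'e set \<Rightarrow> ('e \<Rightarrow> 'v set) \<Rightarrow> 'v \<Rightarrow> 'e set" where
  "incident_edges E ends x = {e \<in> E. x \<in> ends e}"

definition edges_between :: "'e set \<Rightarrow> ('e \<Rightarrow> 'v set) \<Rightarrow> 'v \<Rightarrow> 'v \<Rightarrow> 'e set" where
  "edges_between E ends u v = {e \<in> E. ends e = {u, v}}"

text \<open>
  Cardinals are rendered as cardinal orders, as usual compared by \<open>\<le>o\<close>.  The supremum of the
  cardinalities of the members of a family of subsets of a type is again realised on that type,
  and is determined up to \<open>=o\<close>; \<open>is_card_Sup_card_Sup\<close> and \<open>card_Sup_least\<close> show that it always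
  exists and is least among the upper bounds on arbitrary types.
\<close>

definition is_card_Sup :: "'a set set \<Rightarrow> 'a rel \<Rightarrow> bool" where
  "is_card_Sup F r \<longleftrightarrow>
     Card_order r \<and> (\<forall>A\<in>F. |A| \<le>o r) \<and>
     (\<forall>s :: 'a rel. Card_order s \<and> (\<forall>A\<in>F. |A| \<le>o s) \<longrightarrow> r \<le>o s)"

definition card_Sup :: "'a set set \<Rightarrow> 'a rel" where
  "card_Sup F = (SOME r. is_card_Sup F r)"

lemma is_card_Sup_card_Sup: "is_card_Sup F (card_Sup F)"
proof -
  define R where "R = {s :: 'a rel. Card_order s \<and> (\<forall>A\<in>F. |A| \<le>o s)}"
  have "|UNIV :: 'a set| \<in> R"
    unfolding R_def using card_of_Card_order card_of_mono1[OF subset_UNIV] by blast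
  then have "R \<noteq> {}" by blast
  moreover have "\<forall>r\<in>R. Card_order r" unfolding R_def by blast
  ultimately obtain r where "r \<in> R" "\<forall>s\<in>R. r \<le>o s"
    using exists_minim_Card_order by meson
  then have "is_card_Sup F r"
    unfolding is_card_Sup_def R_def by simp
  then show ?thesis
    unfolding card_Sup_def by (rule someI)
qed

lemma card_Sup_least:
  fixes F :: "'a set set" and s :: "'b rel"
  assumes s: "Card_order s" and ub: "\<And>A. A \<in> F \<Longrightarrow> |A| \<le>o s"
  shows "card_Sup F \<le>o s"
proof (rule ccontr)
  assume "\<not> card_Sup F \<le>o s"
  moreover have "Card_order (card_Sup F)"
    using is_card_Sup_card_Sup[of F] unfolding is_card_Sup_def by (rule conjunct1)
  ultimately have less: "s <o card_Sup F"
    using s not_ordLeq_iff_ordLess card_order_on_well_order_on by metis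
  then obtain t :: "'a rel" where t: "s =o t"
    using internalize_ordLess[of s "card_Sup F"] by metis
  have "Card_order t"
    using s t by (rule Card_order_ordIso2)
  moreover have "|A| \<le>o t" if "A \<in> F" for A
    using ub[OF that] t by (rule ordLeq_ordIso_trans)
  ultimately have "card_Sup F \<le>o t"
    using is_card_Sup_card_Sup[of F] unfolding is_card_Sup_def by simp
  then have "card_Sup F \<le>o s"
    using ordIso_symmetric[OF t] by (rule ordLeq_ordIso_trans)
  with less show False
    by (simp add: not_ordLess_ordLeq)
qed

definition vertex_degree :: "'e set \<Rightarrow> ('e \<Rightarrow> 'v set) \<Rightarrow> 'v \<Rightarrow> 'e rel" where
  "vertex_degree E ends x = |incident_edges E ends x|"

definition sup_multiplicity :: "'v set \<Rightarrow> 'e set \<Rightarrow> ('e \<Rightarrow> 'v set) \<Rightarrow> 'e rel" where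
  "sup_multiplicity V E ends = card_Sup {edges_between E ends u v | u v. u \<in> V \<and> v \<in> V}"

definition good_coloring ::
  "'e set \<Rightarrow> ('e \<Rightarrow> 'v set) \<Rightarrow> nat \<Rightarrow> 'v set \<Rightarrow> ('e \<Rightarrow> nat) \<Rightarrow> bool" where
  "good_coloring E ends n X c \<longleftrightarrow>
     c \<in> E \<rightarrow> {..<n} \<and> (\<forall>x\<in>X. c ` incident_edges E ends x = {..<n})"

end

theory Submission
  imports Defs "HOL-Combinatorics.Transposition" "HOL-Analysis.Function_Topology"
begin

text \<open>
  Suppose first that all multiplicities are at most \<open>m < \<omega>\<close>.  Keeping only \<open>n + m\<close> edges at every
  vertex of \<open>X\<close> and using compactness reduces the claim to finite multigraphs of maximum degree
  \<open>n + m\<close>.  These have a proper edge coloring with \<open>n + 2m\<close> colors by Vizing's theorem.  The edges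
  of the last \<open>2m\<close> colors can be oriented so that at most \<open>m\<close> of them leave any vertex; hence each
  vertex of degree \<open>n + m\<close> has at least \<open>n\<close> edges that either have one of the first \<open>n\<close> colors or
  point to it, and recoloring the latter supplies the colors it misses.  If the supremum of the
  multiplicities is infinite, all degrees in \<open>X\<close> are infinite, and a simple graph is left once the
  infinite parallel classes have been colored.
\<close>

section \<open>Vizing's theorem for finite multigraphs\<close>

definition proper_coloring :: "nat \<Rightarrow> 'e set \<Rightarrow> ('e \<Rightarrow> 'v set) \<Rightarrow> ('e \<Rightarrow> nat) \<Rightarrow> bool" where
  "proper_coloring k E ends c \<longleftrightarrow>
     c ` E \<subseteq> {..<k} \<and> (\<forall>e\<in>E. \<forall>f\<in>E. e \<noteq> f \<longrightarrow> ends e \<inter> ends f \<noteq> {} \<longrightarrow> c e \<noteq> c f)"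

definition missing :: "nat \<Rightarrow> 'e set \<Rightarrow> ('e \<Rightarrow> 'v set) \<Rightarrow> ('e \<Rightarrow> nat) \<Rightarrow> 'v \<Rightarrow> nat set" where
  "missing k E ends c v = {..<k} - c ` incident_edges E ends v"

text \<open>The first edge of a fan is the one that carries no color yet.\<close>

definition fan :: "nat \<Rightarrow> 'e set \<Rightarrow> ('e \<Rightarrow> 'v set) \<Rightarrow> ('e \<Rightarrow> nat) \<Rightarrow> 'v \<Rightarrow> 'e list \<Rightarrow> bool" where
  "fan k E ends c x es \<longleftrightarrow> es \<noteq> [] \<and> distinct es \<and> set es \<subseteq> incident_edges E ends x \<and>
     successively (\<lambda>e f. \<exists>y. ends e = {x, y} \<and> c f \<in> missing k (E - {hd es}) ends c y) es"

section \<open>Fans: moving colors along them and lengthening them\<close>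

lemma proper_coloringD:
  "proper_coloring k E ends c \<Longrightarrow> e \<in> E \<Longrightarrow> f \<in> E \<Longrightarrow> v \<in> ends e \<Longrightarrow> v \<in> ends f \<Longrightarrow>
     c e = c f \<Longrightarrow> e = f"
  unfolding proper_coloring_def by blast

lemma in_missing_iff:
  "a \<in> missing k E ends c v \<longleftrightarrow> a < k \<and> (\<forall>e\<in>E. v \<in> ends e \<longrightarrow> c e \<noteq> a)"
  unfolding missing_def incident_edges_def by auto

lemma card_2_other:
  assumes "card A = 2" and "x \<in> A"
  obtains y where "A = {x, y}" "x \<noteq> y"
  using assms by (metis card_2_iff insert_commute insert_iff singletonD)

lemma fan_last_in: "fan k E ends c x es \<Longrightarrow> last es \<in> E"
  unfolding fan_def incident_edges_def using last_in_set by blast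

text \<open>Vizing's fan recoloring. The uncolored edge takes the color of its successor, which
  becomes the uncolored edge of a shorter fan under a new coloring; hence the induction with
  \<open>c\<close> arbitrary. When one edge is left, \<open>a\<close> is missing at both of its
  ends.\<close>

lemma fan_shift:
  assumes "proper_coloring k (E - {hd es}) ends c" and "fan k E ends c x es"
    and "a \<in> missing k (E - {hd es}) ends c x"
    and "ends (last es) = {x, y}" and "a \<in> missing k (E - {hd es}) ends c y"
  shows "\<exists>c'. proper_coloring k E ends c'"
  using assms
proof (induction es arbitrary: c)
  case Nil
  then show ?case by (simp add: fan_def)
next
  case (Cons e es)
  note proper = Cons.prems(1)[simplified]
  have e: "e \<in> E" "x \<in> ends e"
    using Cons.prems(2) by (auto simp: fan_def incident_edges_def)
  show ?case
  proof (cases es)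
    case Nil
    have "proper_coloring k E ends (c(e := a))"
      using Cons.prems e Nil unfolding proper_coloring_def in_missing_iff
      by (auto 0 3 simp: image_subset_iff)
    then show ?thesis by blast
  next
    case (Cons f fs)
    have f: "f \<in> E" "x \<in> ends f" "f \<noteq> e"
      and dist: "distinct (e # es)" and sub: "set (e # es) \<subseteq> incident_edges E ends x"
      and succ: "successively (\<lambda>e' f. \<exists>y. ends e' = {x, y} \<and>
        c f \<in> missing k (E - {e}) ends c y) es"
      using Cons.prems(2) Cons by (auto simp: fan_def incident_edges_def)
    obtain z where z: "ends e = {x, z}" "c f \<in> missing k (E - {e}) ends c z"
      using Cons.prems(2) Cons by (auto simp: fan_def)
    \<comment> \<open>\<open>d\<close> still has a value at \<open>f\<close>, but from here on
      \<open>f\<close> counts as uncolored.\<close>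
    define d where "d = c(e := c f)"
    have "proper_coloring k (E - {f}) ends d"
      unfolding proper_coloring_def
    proof (intro conjI ballI impI)
      show "d ` (E - {f}) \<subseteq> {..<k}"
        using proper f unfolding proper_coloring_def d_def by auto
      \<comment> \<open>At \<open>x\<close> the color \<open>c f\<close> occurs only on
        \<open>f\<close>, and at \<open>z\<close> it is missing, so \<open>e\<close> can take
        it.\<close>
      have new: "c f \<noteq> c g" if "g \<in> E - {f}" "g \<noteq> e" "v \<in> ends g" "v \<in> ends e" for g v
        using that z proper_coloringD[OF proper, of f g x] f unfolding in_missing_iff by auto
      fix g h assume gh: "g \<in> E - {f}" "h \<in> E - {f}" "g \<noteq> h" "ends g \<inter> ends h \<noteq> {}"
      then obtain v where v: "v \<in> ends g" "v \<in> ends h" by blast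
      show "d g \<noteq> d h"
        using new[of g v] new[of h v] gh v proper_coloringD[OF proper, of g h v]
        unfolding d_def by auto
    qed
    moreover have "fan k E ends d x es"
      unfolding fan_def
    proof (intro conjI)
      show "successively (\<lambda>g h. \<exists>y. ends g = {x, y} \<and> d h \<in> missing k (E - {hd es}) ends d y) es"
        unfolding successively_conv_nth
      proof (intro allI impI)
        fix i assume i: "Suc i < length es"
        let ?h = "es ! Suc i"
        obtain w where w: "ends (es ! i) = {x, w}" "c ?h \<in> missing k (E - {e}) ends c w"
          using succ i unfolding successively_conv_nth by blast
        have "?h \<in> set es" using i by simp
        then have h: "?h \<noteq> e" "?h \<in> E" "x \<in> ends ?h"
          using dist sub by (auto simp: incident_edges_def)
        \<comment> \<open>The recolored \<open>e\<close> could only spoil a tip that needs the color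
          \<open>c f\<close>, and the later fan edges have other colors since all of them meet at
          \<open>x\<close>.\<close>
        have "?h \<noteq> f" using dist i Cons by (auto simp: nth_Cons')
        then have "c ?h \<noteq> c f"
          using proper_coloringD[OF proper, of ?h f x] h f by auto
        then have "d ?h \<in> missing k (E - {hd es}) ends d w"
          using w(2) h Cons unfolding d_def in_missing_iff by auto
        with w(1) show "\<exists>y. ends (es ! i) = {x, y} \<and> d ?h \<in> missing k (E - {hd es}) ends d y"
          by blast
      qed
    qed (use Cons dist sub in auto)
    moreover have "a \<in> missing k (E - {hd es}) ends d v"
      if "a \<in> missing k (E - {e}) ends c v" for v
      using that Cons.prems(3) f Cons unfolding d_def in_missing_iff by auto
    ultimately show ?thesis
      using Cons.IH[of d] Cons.prems(3,4,5) Cons by simp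
  qed
qed

lemma fan_prefix:
  "fan k E ends c x (ys @ e # zs) \<Longrightarrow> fan k E ends c x (ys @ [e])"
  using successively_append_iff[of _ "ys @ [e]" zs]
  unfolding fan_def by (cases ys) auto

text \<open>If \<open>f\<close> already occurs in the fan, the fan is cut off there; otherwise
  \<open>f\<close> is appended.\<close>

lemma exists_fan_extend:
  assumes es: "fan k E ends c x es" and y: "ends (last es) = {x, y}"
    and f: "f \<in> incident_edges E ends x" "c f \<in> missing k (E - {hd es}) ends c y"
  shows "\<exists>fs. fan k E ends c x fs \<and> hd fs = hd es \<and> last fs = f"
proof (cases "f \<in> set es")
  case True
  then obtain ys zs where "es = ys @ f # zs" by (meson split_list)
  then show ?thesis using fan_prefix[of k E ends c x ys f zs] es
    by (intro exI[of _ "ys @ [f]"]) (cases ys; simp)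
next
  case False
  then have "fan k E ends c x (es @ [f])"
    using assms unfolding fan_def by (auto simp: successively_append_iff)
  then show ?thesis using es by (intro exI[of _ "es @ [f]"]) (auto simp: fan_def)
qed

section \<open>Kempe chains and color swaps\<close>

text \<open>In a graph of maximum degree 2 the component of an end of a path has at most one other end;
  removing the end peels the path off one edge at a time.\<close>

lemma exists_closed_set_two_ends:
  assumes "finite F" and "\<And>e. e \<in> F \<Longrightarrow> card (ends e) = 2"
    and "\<And>v. card (incident_edges F ends v) \<le> 2" and "card (incident_edges F ends x) \<le> 1"
  shows "\<exists>C z. x \<in> C \<and> (\<forall>e\<in>F. ends e \<inter> C \<noteq> {} \<longrightarrow> ends e \<subseteq> C) \<and>
    (\<forall>v\<in>C. card (incident_edges F ends v) \<le> 1 \<longrightarrow> v \<in> {x, z})"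
  using assms
proof (induction "card F" arbitrary: F x rule: less_induct)
  case less
  have fin: "finite (incident_edges G ends v)" if "G \<subseteq> F" for v G
    using less.prems(1) finite_subset[OF that] by (auto simp: incident_edges_def)
  show ?case
  proof (cases "incident_edges F ends x = {}")
    case True
    then show ?thesis
      by (intro exI[of _ "{x}"] exI[of _ x]) (auto simp: incident_edges_def)
  next
    case False
    then have "card (incident_edges F ends x) = 1"
      using less.prems(4) card_0_eq[OF fin[OF order_refl, of x]] by linarith
    then obtain e where ex: "incident_edges F ends x = {e}"
      by (meson card_1_singletonE)
    then have e: "e \<in> F" "x \<in> ends e" by (auto simp: incident_edges_def)
    then obtain w where w: "ends e = {x, w}" "x \<noteq> w"
      using less.prems(2)[of e] card_2_other by metis
    define G where "G = F - {e}"
    have inc: "incident_edges F ends v =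
        (if v \<in> {x, w} then insert e (incident_edges G ends v) else incident_edges G ends v)" for v
      using e w by (auto simp: G_def incident_edges_def)
    have enotin: "e \<notin> incident_edges G ends v" for v
      by (simp add: G_def incident_edges_def)
    have xG: "x \<notin> ends f" if "f \<in> G" for f
      using ex that by (auto simp: G_def incident_edges_def)
    have finG: "finite (incident_edges G ends v)" for v
      by (rule fin) (auto simp: G_def)
    have degw: "card (incident_edges F ends w) = Suc (card (incident_edges G ends w))"
      using inc[of w] enotin finG by simp
    show ?thesis
    proof (cases "incident_edges G ends w = {}")
      case True
      then have "ends f \<inter> {x, w} = {}" if "f \<in> G" for f
        using that xG[OF that] by (auto simp: incident_edges_def)
      then show ?thesis
        using w by (intro exI[of _ "{x, w}"] exI[of _ w]) (auto simp: G_def)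
    next
      case False
      have "card (incident_edges G ends v) \<le> 2" for v
      proof -
        have "card (incident_edges G ends v) \<le> card (incident_edges F ends v)"
          using fin[OF order_refl] by (rule card_mono) (auto simp: G_def incident_edges_def)
        then show ?thesis using less.prems(3)[of v] by linarith
      qed
      moreover have "card (incident_edges G ends w) \<le> 1"
        using degw less.prems(3)[of w] by simp
      moreover have "card G < card F"
        using e less.prems(1) unfolding G_def by (intro card_Diff1_less)
      ultimately obtain C z where C: "w \<in> C" "\<forall>f\<in>G. ends f \<inter> C \<noteq> {} \<longrightarrow> ends f \<subseteq> C"
        "\<forall>v\<in>C. card (incident_edges G ends v) \<le> 1 \<longrightarrow> v \<in> {w, z}"
        using less.hyps[of G w] less.prems(1,2) by (auto simp: G_def)
      \<comment> \<open>In \<open>G\<close> the vertex \<open>w\<close> was an end, but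
        \<open>e\<close> gives it degree 2 in \<open>F\<close>; so \<open>x\<close> replaces
        \<open>w\<close> in the list of possible ends.\<close>
      have "card (incident_edges F ends w) > 1"
        using False finG degw by (simp add: card_gt_0_iff)
      then have "v \<in> {x, z}" if "v \<in> insert x C" "card (incident_edges F ends v) \<le> 1" for v
        using that C(3) inc[of v] by (cases "v = w") (auto split: if_splits)
      moreover have "ends f \<subseteq> insert x C" if "f \<in> F" "ends f \<inter> insert x C \<noteq> {}" for f
        using that C(1,2) w xG by (cases "f = e") (auto simp: G_def)
      ultimately show ?thesis
        by (intro exI[of _ "insert x C"] exI[of _ z]) simp
    qed
  qed
qed

text \<open>A Kempe change on all components outside \<open>C\<close> at once. An edge colored
  \<open>a\<close> or \<open>b\<close> lies entirely inside or entirely outside \<open>C\<close>, so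
  at each vertex the two colors are either all kept or all exchanged.\<close>

lemma swap_colors_outside:
  assumes proper: "proper_coloring k E ends c" and ab: "a < k" "b < k"
    and closed: "\<And>e. e \<in> E \<Longrightarrow> c e \<in> {a, b} \<Longrightarrow> ends e \<inter> C \<noteq> {} \<Longrightarrow> ends e \<subseteq> C"
  obtains d where "proper_coloring k E ends d"
    and "\<And>e v. e \<in> E \<Longrightarrow> v \<in> ends e \<Longrightarrow> v \<in> C \<Longrightarrow> d e = c e"
    and "\<And>e v. e \<in> E \<Longrightarrow> v \<in> ends e \<Longrightarrow> v \<notin> C \<Longrightarrow> d e = transpose a b (c e)"
proof
  define d where "d e = (if ends e \<inter> C = {} then transpose a b (c e) else c e)" for e
  show inC: "d e = c e" if "e \<in> E" "v \<in> ends e" "v \<in> C" for e v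
    using that by (auto simp: d_def)
  show outC: "d e = transpose a b (c e)" if "e \<in> E" "v \<in> ends e" "v \<notin> C" for e v
  proof (cases "ends e \<inter> C = {}")
    case False
    then have "c e \<notin> {a, b}" using closed[of e] that by blast
    then show ?thesis by (simp add: d_def False transpose_def)
  qed (simp add: d_def)
  show "proper_coloring k E ends d"
    unfolding proper_coloring_def
  proof (intro conjI ballI impI)
    show "d ` E \<subseteq> {..<k}"
      using proper ab by (auto simp: d_def proper_coloring_def transpose_def)
    fix e f assume ef: "e \<in> E" "f \<in> E" "e \<noteq> f" "ends e \<inter> ends f \<noteq> {}"
    then obtain v where v: "v \<in> ends e" "v \<in> ends f" by blast
    have "c e \<noteq> c f" using proper ef unfolding proper_coloring_def by blast
    then show "d e \<noteq> d f"
      using inC[OF ef(1) v(1)] inC[OF ef(2) v(2)] outC[OF ef(1) v(1)] outC[OF ef(2) v(2)]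
      by (cases "v \<in> C") (auto simp: transpose_eq_iff)
  qed
qed

text \<open>A vertex missing \<open>a\<close> or \<open>b\<close> is an end in the graph of edges
  with these two colors. The component of \<open>x\<close> has at most one other end, so one of two
  distinct tips lies outside it. Swapping \<open>a\<close> and \<open>b\<close> outside makes
  \<open>a\<close> missing at that tip while it stays missing at \<open>x\<close>, and a shift then
  colors all of \<open>E\<close>.\<close>

lemma fan_missing_disjoint:
  assumes fin: "finite E" and card2: "\<And>e. e \<in> E \<Longrightarrow> card (ends e) = 2"
    and none: "\<nexists>c'. proper_coloring k E ends c'"
    and proper: "proper_coloring k (E - {e0}) ends c"
    and a: "a \<in> missing k (E - {e0}) ends c x"
    and us: "fan k E ends c x us" "hd us = e0" "ends (last us) = {x, u}"
    and vs: "fan k E ends c x vs" "hd vs = e0" "ends (last vs) = {x, v}"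
    and b: "b \<in> missing k (E - {e0}) ends c u" "b \<in> missing k (E - {e0}) ends c v"
  shows "u = v"
proof (rule ccontr)
  assume "u \<noteq> v"
  define D where "D = E - {e0}"
  define F where "F = {e \<in> D. c e \<in> {a, b}}"
  note proper = proper[folded D_def] and a = a[folded D_def] and b = b[folded D_def]
  have xneq: "x \<noteq> w" if "fan k E ends c x es" "ends (last es) = {x, w}" for es w
  proof -
    have "last es \<in> E"
      using that(1) by (rule fan_last_in)
    then show ?thesis using card2[of "last es"] that(2) by (auto simp: card_insert_if)
  qed
  have ab: "a < k" "b < k" using a b by (auto simp: in_missing_iff)
  have degF: "card (incident_edges F ends w) \<le> card ({a, b} - missing k D ends c w)" for w
  proof (rule card_inj_on_le[of c])
    show "inj_on c (incident_edges F ends w)"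
      using proper_coloringD[OF proper, of _ _ w]
      by (auto simp: inj_on_def F_def incident_edges_def)
    show "c ` incident_edges F ends w \<subseteq> {a, b} - missing k D ends c w"
      by (auto simp: F_def incident_edges_def in_missing_iff)
  qed simp
  have ends1: "card (incident_edges F ends w) \<le> 1"
    if "a \<in> missing k D ends c w \<or> b \<in> missing k D ends c w" for w
  proof -
    have "{a, b} - missing k D ends c w \<subseteq> {a} \<or> {a, b} - missing k D ends c w \<subseteq> {b}"
      using that by blast
    then have "card ({a, b} - missing k D ends c w) \<le> 1"
      by (auto dest!: card_mono[rotated])
    then show ?thesis using degF[of w] by linarith
  qed
  have "card (incident_edges F ends w) \<le> 2" for w
    using degF[of w] card_mono[of "{a, b}" "{a, b} - missing k D ends c w"] card_insert_le_m1[of 2 "{b}" a]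
    by (auto intro: order_trans)
  moreover have "finite F" "\<And>e. e \<in> F \<Longrightarrow> card (ends e) = 2"
    using fin card2 by (auto simp: F_def D_def)
  ultimately obtain C z where C: "x \<in> C" "\<forall>e\<in>F. ends e \<inter> C \<noteq> {} \<longrightarrow> ends e \<subseteq> C"
    "\<forall>w\<in>C. card (incident_edges F ends w) \<le> 1 \<longrightarrow> w \<in> {x, z}"
    using exists_closed_set_two_ends[of F ends x] ends1[of x] a by blast
  \<comment> \<open>Tips that miss \<open>a\<close> after the swap. The shortest such fan is taken,
    because the swap might destroy the fan property of a longer one.\<close>
  define bad where "bad es \<longleftrightarrow> fan k E ends c x es \<and> hd es = e0 \<and>
    (\<exists>y. ends (last es) = {x, y} \<and> y \<notin> C \<and> b \<in> missing k D ends c y)" for es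
  have "u \<notin> C \<or> v \<notin> C"
    using C(3) ends1[of u] ends1[of v] b xneq[OF us(1,3)] xneq[OF vs(1,3)] \<open>u \<noteq> v\<close> by blast
  then have "bad us \<or> bad vs" using us vs b unfolding bad_def by blast
  then obtain es where "bad es" and min: "\<And>fs. length fs < length es \<Longrightarrow> \<not> bad fs"
    using ex_has_least_nat[of bad _ length] by (metis not_le)
  then obtain y where es: "fan k E ends c x es" "hd es = e0" "ends (last es) = {x, y}"
    and y: "y \<notin> C" "b \<in> missing k D ends c y"
    unfolding bad_def by blast
  obtain d where d: "proper_coloring k D ends d"
    and inC: "\<And>e w. e \<in> D \<Longrightarrow> w \<in> ends e \<Longrightarrow> w \<in> C \<Longrightarrow> d e = c e"
    and outC: "\<And>e w. e \<in> D \<Longrightarrow> w \<in> ends e \<Longrightarrow> w \<notin> C \<Longrightarrow> d e = transpose a b (c e)"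
    using swap_colors_outside[OF proper ab, of C] C(2) unfolding F_def by blast
  have missC: "missing k D ends d w = missing k D ends c w" if "w \<in> C" for w
    using inC[of _ w] that by (auto simp: in_missing_iff)
  have missO: "transpose a b i \<in> missing k D ends d w"
    if "i \<in> missing k D ends c w" "w \<notin> C" for w i
    using that ab outC[of _ w] by (auto simp: in_missing_iff transpose_eq_iff) (auto simp: transpose_def)
  have "fan k E ends d x es"
    unfolding fan_def
  proof (intro conjI)
    show "es \<noteq> []" "distinct es" "set es \<subseteq> incident_edges E ends x"
      using es(1) by (auto simp: fan_def)
    show "successively (\<lambda>g h. \<exists>y. ends g = {x, y} \<and> d h \<in> missing k (E - {hd es}) ends d y) es"
      unfolding successively_conv_nth
    proof (intro allI impI)
      fix i assume i: "Suc i < length es"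
      let ?g = "es ! i" and ?h = "es ! Suc i"
      obtain w where w: "ends ?g = {x, w}" "c ?h \<in> missing k D ends c w"
        using es(1,2) i unfolding fan_def successively_conv_nth D_def by blast
      have "?h \<in> set es" using i by simp
      moreover have "?h \<noteq> hd es"
        using es(1) i by (auto simp: fan_def hd_conv_nth nth_eq_iff_index_eq)
      ultimately have h: "?h \<in> D" "x \<in> ends ?h"
        using es(1,2) by (auto simp: fan_def incident_edges_def D_def)
      then have dh: "d ?h = c ?h" using inC C(1) by blast
      have ha: "c ?h \<noteq> a" using a h by (auto simp: in_missing_iff)
      have "d ?h \<in> missing k D ends d w"
      proof (cases "w \<in> C")
        case True
        then show ?thesis using missC w dh by simp
      next
        case False
        \<comment> \<open>By minimality the shorter fan ending in \<open>?g\<close> is not bad, so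
          \<open>b\<close> is present at \<open>w\<close>. Hence the color of \<open>?h\<close>,
          missing at \<open>w\<close>, is neither \<open>b\<close> nor \<open>a\<close>, and the
          swap does not affect it.\<close>
        have split: "es = take i es @ ?g # drop (Suc i) es"
          using i by (simp add: id_take_nth_drop)
        let ?fs = "take i es @ [?g]"
        have "fan k E ends c x ?fs" using es(1) split fan_prefix by metis
        moreover have "hd ?fs = e0" using es(2) i by (cases es; cases i) auto
        moreover have "\<not> bad ?fs" using min[of ?fs] i by simp
        moreover have "ends (last ?fs) = {x, w}" using w(1) by simp
        ultimately have "b \<notin> missing k D ends c w"
          using False unfolding bad_def by blast
        then have "c ?h \<noteq> b" using w(2) by auto
        then have "transpose a b (c ?h) = c ?h" using ha by (simp add: transpose_def)
        then show ?thesis using missO[OF w(2) False] dh by simp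
      qed
      then show "\<exists>y. ends ?g = {x, y} \<and> d ?h \<in> missing k (E - {hd es}) ends d y"
        using w(1) es(2) unfolding D_def by blast
    qed
  qed
  moreover have "a \<in> missing k D ends d y" using missO[OF y(2,1)] by simp
  moreover have "a \<in> missing k D ends d x" using missC[OF C(1)] a by simp
  ultimately have "\<exists>c'. proper_coloring k E ends c'"
    using fan_shift[of k E es ends d x a y] d es(2,3) unfolding D_def by simp
  with none show False by blast
qed

text \<open>If the coloring cannot be extended, the colors missing at the tips of all fans are
  pairwise disjoint sets, and each of these colors sits on an edge from \<open>x\<close> to a tip.  There are
  too few such edges.\<close>

lemma extend_proper_coloring:
  assumes fin: "finite E" and card2: "\<And>e. e \<in> E \<Longrightarrow> card (ends e) = 2"
    and deg: "\<And>v. card (incident_edges E ends v) \<le> D"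
    and mult: "\<And>p. card {e \<in> E. ends e = p} \<le> m"
    and e0: "e0 \<in> E" and proper: "proper_coloring (D + m) (E - {e0}) ends c"
  shows "\<exists>c'. proper_coloring (D + m) E ends c'"
proof (rule ccontr)
  assume none: "\<nexists>c'. proper_coloring (D + m) E ends c'"
  obtain x y0 where xy0: "ends e0 = {x, y0}" using card2[OF e0] by (meson card_2_iff)
  define M where "M = missing (D + m) (E - {e0}) ends c"
  have finI: "finite (incident_edges E ends v)" for v
    using fin by (simp add: incident_edges_def)
  have cardM: "D + m \<le> card (M v) + card (incident_edges (E - {e0}) ends v)" for v
  proof -
    have "D + m - card (c ` incident_edges (E - {e0}) ends v) \<le> card (M v)"
      unfolding M_def missing_def using diff_card_le_card_Diff[of "c ` incident_edges (E - {e0}) ends v" "{..<D + m}"]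
        fin by (simp add: incident_edges_def)
    moreover have "card (c ` incident_edges (E - {e0}) ends v) \<le> card (incident_edges (E - {e0}) ends v)"
      using fin by (intro card_image_le) (simp add: incident_edges_def)
    ultimately show ?thesis by linarith
  qed
  have M_ge: "m \<le> card (M v)" for v
  proof -
    have "card (incident_edges (E - {e0}) ends v) \<le> card (incident_edges E ends v)"
      using finI[of v] by (rule card_mono) (auto simp: incident_edges_def)
    then show ?thesis using cardM[of v] deg[of v] by linarith
  qed
  \<comment> \<open>The ends of the uncolored edge miss one color more than the general bound; this
    surplus decides the final count.\<close>
  have M_gt: "m < card (M v)" if "v \<in> ends e0" for v
  proof -
    have "incident_edges (E - {e0}) ends v \<subset> incident_edges E ends v"
      using that e0 by (auto simp: incident_edges_def)
    then have "card (incident_edges (E - {e0}) ends v) < card (incident_edges E ends v)"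
      by (rule psubset_card_mono[OF finI])
    then show ?thesis using cardM[of v] deg[of v] by linarith
  qed
  obtain a where a: "a \<in> M x"
    using M_gt[of x] xy0 by (cases "M x = {}") auto
  \<comment> \<open>The tips of all fans at \<open>x\<close> that start with
    \<open>e0\<close>.\<close>
  define Y where "Y = {y. \<exists>es. fan (D + m) E ends c x es \<and> hd es = e0 \<and> ends (last es) = {x, y}}"
  have "fan (D + m) E ends c x [e0]" using e0 xy0 by (simp add: fan_def incident_edges_def)
  then have y0: "y0 \<in> Y" unfolding Y_def using xy0 by (intro CollectI exI[of _ "[e0]"]) auto
  have finY: "finite Y"
  proof (rule finite_subset)
    show "Y \<subseteq> \<Union>(ends ` E)"
    proof
      fix y assume "y \<in> Y"
      then obtain es where "fan (D + m) E ends c x es" "ends (last es) = {x, y}"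
        unfolding Y_def by blast
      then have "last es \<in> E" "y \<in> ends (last es)"
        using fan_last_in by auto
      then show "y \<in> \<Union>(ends ` E)" by blast
    qed
    show "finite (\<Union>(ends ` E))"
      using fin card2 by (auto intro: card_ge_0_finite)
  qed
  have disj: "M u \<inter> M v = {}" if "u \<in> Y" "v \<in> Y" "u \<noteq> v" for u v
    using fan_missing_disjoint[OF fin card2 none proper] a that unfolding M_def Y_def by blast
  have disjx: "M x \<inter> M y = {}" if "y \<in> Y" for y
    using that none fan_shift[of "D + m" E _ ends c x _ y] proper unfolding M_def Y_def by blast
  define B where "B y = {e \<in> E - {e0}. ends e = {x, y}}" for y
  \<comment> \<open>A color missing at a tip is present at \<open>x\<close>, on some edge
    \<open>f\<close>. Lengthening the fan by \<open>f\<close> shows that the other end of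
    \<open>f\<close> is a tip too.\<close>
  have "\<Union>(M ` Y) \<subseteq> c ` \<Union>(B ` Y)"
  proof
    fix b assume "b \<in> \<Union>(M ` Y)"
    then obtain y where y: "y \<in> Y" "b \<in> M y" by blast
    then have "b \<notin> M x" using disjx by blast
    then obtain f where f: "f \<in> E - {e0}" "x \<in> ends f" "c f = b"
      using y(2) unfolding M_def in_missing_iff by blast
    obtain es where "fan (D + m) E ends c x es" "hd es = e0" "ends (last es) = {x, y}"
      using y(1) unfolding Y_def by blast
    then obtain fs where fs: "fan (D + m) E ends c x fs" "hd fs = e0" "last fs = f"
      using exists_fan_extend[of "D + m" E ends c x es y f] f y(2)
      unfolding M_def incident_edges_def by auto
    obtain w where "ends f = {x, w}"
      using card2[of f] f card_2_other by (metis DiffD1)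
    then have "w \<in> Y" "f \<in> B w" using fs f unfolding Y_def B_def by auto
    then show "b \<in> c ` \<Union>(B ` Y)" using f(3) by blast
  qed
  moreover have finB: "finite (\<Union>(B ` Y))" using fin finY by (simp add: B_def)
  ultimately have "card (\<Union>(M ` Y)) \<le> card (\<Union>(B ` Y))"
    by (meson card_image_le card_mono finite_imageI le_trans)
  also have "\<dots> \<le> (\<Sum>y\<in>Y. card (B y))" using finY by (rule card_UN_le)
  also have "\<dots> \<le> (\<Sum>y\<in>Y. m)"
  proof (rule sum_mono)
    fix y
    have "card (B y) \<le> card {e \<in> E. ends e = {x, y}}"
      using fin by (intro card_mono) (auto simp: B_def)
    then show "card (B y) \<le> m" using mult[of "{x, y}"] by linarith
  qed
  \<comment> \<open>Strict because \<open>y0\<close>, an end of \<open>e0\<close>, is one of the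
    tips.\<close>
  also have "\<dots> < (\<Sum>y\<in>Y. card (M y))"
    using M_ge M_gt[of y0] y0 xy0 finY by (intro sum_strict_mono_ex1) auto
  also have "\<dots> = card (\<Union>(M ` Y))"
    using finY disj by (intro card_UN_disjoint[symmetric]) (auto simp: M_def missing_def)
  finally show False by simp
qed

text \<open>The edges are inserted one at a time; both bounds pass to subgraphs.\<close>

theorem vizing:
  assumes "finite E" and "\<And>e. e \<in> E \<Longrightarrow> card (ends e) = 2"
    and "\<And>v. card (incident_edges E ends v) \<le> D"
    and "\<And>p. card {e \<in> E. ends e = p} \<le> m"
  shows "\<exists>c. proper_coloring (D + m) E ends c"
  using assms
proof (induction E rule: finite_induct)
  case empty
  then show ?case by (simp add: proper_coloring_def)
next
  case (insert e E)
  have "card (incident_edges E ends v) \<le> D" for v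
    using insert.prems(2)[of v] insert.hyps(1)
      card_mono[of "incident_edges (insert e E) ends v" "incident_edges E ends v"]
    by (fastforce simp: incident_edges_def)
  moreover have "card {f \<in> E. ends f = p} \<le> m" for p
    using insert.prems(3)[of p] insert.hyps(1)
      card_mono[of "{f \<in> insert e E. ends f = p}" "{f \<in> E. ends f = p}"]
    by fastforce
  ultimately obtain c where "proper_coloring (D + m) E ends c"
    using insert.IH insert.prems(1) by blast
  then show ?case
    using insert.hyps insert.prems
    by (intro extend_proper_coloring[of "insert e E" ends D m e c]) auto
qed

section \<open>Gupta's theorem for finite multigraphs\<close>

lemma card_Collect_insert:
  "finite S \<Longrightarrow> e \<notin> S \<Longrightarrow>
     card {f \<in> insert e S. P f} = of_bool (P e) + card {f \<in> S. P f}"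
proof -
  assume "finite S" "e \<notin> S"
  moreover have "{f \<in> insert e S. P f} = (if P e then insert e {f \<in> S. P f} else {f \<in> S. P f})"
    by auto
  ultimately show ?thesis by simp
qed

text \<open>Two edges \<open>pv\<close> and \<open>vq\<close> are merged into a single edge \<open>pq\<close>, whose orientation is then
  passed on to both of them.\<close>

lemma exists_balanced_orientation:
  fixes a b :: "'e \<Rightarrow> 'v"
  assumes "finite R"
  shows "\<exists>t h. (\<forall>e\<in>R. {t e, h e} = {a e, b e}) \<and>
    (\<forall>v. card {e \<in> R. t e = v} \<le> Suc (card {e \<in> R. h e = v}))"
  using assms
proof (induction "card R" arbitrary: R a b rule: less_induct)
  case less
  show ?case
  proof (cases "\<exists>e1\<in>R. \<exists>e2\<in>R. e1 \<noteq> e2 \<and> {a e1, b e1} \<inter> {a e2, b e2} \<noteq> {}")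
    case False
    \<comment> \<open>If no two edges meet, every vertex is a tail at most once in any
      orientation.\<close>
    have "card {e \<in> R. a e = v} \<le> Suc 0" for v
      using False less.prems by (subst card_le_Suc0_iff_eq) auto
    then have "card {e \<in> R. a e = v} \<le> Suc (card {e \<in> R. b e = v})" for v
      by (meson Suc_le_mono le_trans zero_le)
    then show ?thesis by blast
  next
    case True
    then obtain e1 e2 v where e: "e1 \<in> R" "e2 \<in> R" "e1 \<noteq> e2"
      and v: "v \<in> {a e1, b e1}" "v \<in> {a e2, b e2}"
      by blast
    obtain p where p: "{a e1, b e1} = {p, v}" using v(1) by blast
    obtain q where q: "{a e2, b e2} = {v, q}" using v(2) by blast
    define S where "S = R - {e1, e2}"
    have S: "finite S" "e1 \<notin> S" "e2 \<notin> S" "R = insert e1 (insert e2 S)"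
      "R - {e2} = insert e1 S"
      using e less.prems by (auto simp: S_def)
    have "card (R - {e2}) < card R" using e less.prems by (intro card_Diff1_less)
    \<comment> \<open>The merged edge keeps the name \<open>e1\<close> and \<open>e2\<close> is
      deleted. It is a loop if \<open>p = q\<close>, which the statement allows.\<close>
    then obtain t h where th: "\<forall>e\<in>R - {e2}. {t e, h e} = {(a(e1 := p)) e, (b(e1 := q)) e}"
      and bal: "\<forall>u. card {e \<in> R - {e2}. t e = u} \<le> Suc (card {e \<in> R - {e2}. h e = u})"
      using less.hyps[of "R - {e2}" "a(e1 := p)" "b(e1 := q)"] less.prems by auto
    have thS: "{t f, h f} = {a f, b f}" if "f \<in> S" for f
      using th that S by (metis fun_upd_other insertCI)
    have th1: "{t e1, h e1} = {p, q}" using th e by auto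
    have count: "card {f \<in> R. s f = u} = of_bool (s e1 = u) + of_bool (s e2 = u) + card {f \<in> S. s f = u}"
      for s :: "'e \<Rightarrow> 'v" and u
    proof -
      have "finite (insert e2 S)" "e1 \<notin> insert e2 S" using S e(3) by auto
      then show ?thesis
        unfolding S(4)
        using card_Collect_insert[of "insert e2 S" e1 "\<lambda>f. s f = u"]
          card_Collect_insert[OF S(1,3), of "\<lambda>f. s f = u"]
        by linarith
    qed
    have bal': "of_bool (t e1 = u) + card {f \<in> S. t f = u} \<le>
        Suc (of_bool (h e1 = u) + card {f \<in> S. h f = u})" for u
      using bal[rule_format, of u, unfolded S(5) card_Collect_insert[OF S(1,2)]] .
    consider "t e1 = p" "h e1 = q" | "t e1 = q" "h e1 = p"
      using th1 by (auto simp: doubleton_eq_iff)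
    then show ?thesis
    proof cases
      \<comment> \<open>The path is directed from \<open>p\<close> through \<open>v\<close> to
        \<open>q\<close>, so \<open>v\<close> gains one head and one tail and the other differences
        are unchanged. The second case is the reverse path.\<close>
      case 1
      let ?t = "t(e2 := v)" and ?h = "h(e1 := v, e2 := q)"
      have "{f \<in> S. ?t f = u} = {f \<in> S. t f = u}" "{f \<in> S. ?h f = u} = {f \<in> S. h f = u}" for u
        using S by auto
      then have "card {f \<in> R. ?t f = u} \<le> Suc (card {f \<in> R. ?h f = u})" for u
        using bal'[of u] e(3) 1 unfolding count[of ?t] count[of ?h] by simp
      moreover have "\<forall>f\<in>R. {?t f, ?h f} = {a f, b f}"
        using thS S p q 1 e by auto
      ultimately show ?thesis by blast
    next
      case 2
      let ?t = "t(e1 := v, e2 := q)" and ?h = "h(e2 := v)"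
      have "{f \<in> S. ?t f = u} = {f \<in> S. t f = u}" "{f \<in> S. ?h f = u} = {f \<in> S. h f = u}" for u
        using S by auto
      then have "card {f \<in> R. ?t f = u} \<le> Suc (card {f \<in> R. ?h f = u})" for u
        using bal'[of u] e(3) 2 unfolding count[of ?t] count[of ?h] by simp
      moreover have "\<forall>f\<in>R. {?t f, ?h f} = {a f, b f}"
        using thS S p q 2 e by auto
      ultimately show ?thesis by blast
    qed
  qed
qed

text \<open>Invert an injection of \<open>B\<close> into \<open>A\<close>. Elsewhere the value is 0,
  a legal color because \<open>1 \<le> n\<close>. This serves both the edges pointing to a vertex
  and the infinite parallel classes.\<close>

lemma exists_function_covering:
  fixes n :: nat
  assumes "1 \<le> n" and "B \<subseteq> {..<n}" and "infinite A \<or> card B \<le> card A"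
  shows "\<exists>g. range g \<subseteq> {..<n} \<and> B \<subseteq> g ` A"
proof -
  have finB: "finite B" using assms(2) finite_subset by blast
  obtain A' where A': "finite A'" "card B \<le> card A'" "A' \<subseteq> A"
  proof (cases "finite A")
    case True
    then show ?thesis using assms(3) that by blast
  next
    case False
    then show ?thesis using infinite_arbitrarily_large[of A "card B"] that by auto
  qed
  then obtain f where f: "f ` B \<subseteq> A'" "inj_on f B" using card_le_inj[OF finB] by blast
  let ?g = "\<lambda>e. if e \<in> f ` B then inv_into B f e else 0"
  have "range ?g \<subseteq> {..<n}" using assms(1,2) inv_into_into[of _ f B] by auto
  moreover have "b \<in> ?g ` A" if "b \<in> B" for b
    using f A'(3) that by (intro image_eqI[of _ _ "f b"]) auto
  ultimately show ?thesis by blast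
qed

text \<open>Split the colors of a proper coloring with \<open>n + 2m\<close> colors into \<open>n\<close> colors, which are kept,
  and \<open>2m\<close> others, whose edges form a graph of maximum degree \<open>2m\<close>.  In a balanced orientation of
  the latter at most \<open>m\<close> edges leave a vertex; every edge is recolored for the benefit of its head.\<close>

theorem gupta_finite:
  assumes fin: "finite E" and card2: "\<And>e. e \<in> E \<Longrightarrow> card (ends e) = 2" and n: "1 \<le> n"
    and deg: "\<And>v. card (incident_edges E ends v) \<le> n + m"
    and mult: "\<And>p. card {e \<in> E. ends e = p} \<le> m"
  shows "\<exists>c. range c \<subseteq> {..<n} \<and>
    (\<forall>v. card (incident_edges E ends v) = n + m \<longrightarrow> {..<n} \<subseteq> c ` incident_edges E ends v)"
proof -
  obtain c where c: "proper_coloring (n + m + m) E ends c"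
    using vizing[OF fin card2 deg mult] by blast
  define R where "R = {e \<in> E. n \<le> c e}"
  have finR: "finite R" using fin by (simp add: R_def)
  have "\<forall>e\<in>E. \<exists>a b. ends e = {a, b} \<and> a \<noteq> b" using card2 by (meson card_2_iff)
  then obtain a b where ab: "\<forall>e\<in>E. ends e = {a e, b e} \<and> a e \<noteq> b e" by metis
  obtain t h where th: "\<forall>e\<in>R. {t e, h e} = {a e, b e}"
    and bal: "\<forall>v. card {e \<in> R. t e = v} \<le> Suc (card {e \<in> R. h e = v})"
    using exists_balanced_orientation[OF finR, of a b] by blast
  have thR: "ends e = {t e, h e}" "t e \<noteq> h e" if "e \<in> R" for e
  proof -
    have "{t e, h e} = {a e, b e}" "ends e = {a e, b e}" "a e \<noteq> b e"
      using that th ab by (auto simp: R_def)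
    then show "ends e = {t e, h e}" "t e \<noteq> h e" by auto
  qed
  define K where "K v = {e \<in> incident_edges E ends v. c e < n}" for v
  have inj: "inj_on c (incident_edges E ends v)" for v
    using proper_coloringD[OF c, of _ _ v] by (auto simp: inj_on_def incident_edges_def)
  have "\<exists>g. range g \<subseteq> {..<n} \<and> (card (incident_edges E ends v) = n + m \<longrightarrow>
      {..<n} - c ` K v \<subseteq> g ` {e \<in> R. h e = v})" for v
  proof (cases "card (incident_edges E ends v) = n + m")
    case True
    let ?T = "{e \<in> R. t e = v}" and ?H = "{e \<in> R. h e = v}"
    have split: "incident_edges E ends v = K v \<union> (?T \<union> ?H)"
      using thR(1) by (fastforce simp: K_def R_def incident_edges_def)
    have finK: "finite (K v)" using fin by (simp add: K_def incident_edges_def)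
    have TH: "card (?T \<union> ?H) = card ?T + card ?H"
      using finR thR(2) by (intro card_Un_disjoint) fastforce+
    have "card (incident_edges E ends v) = card (K v) + card (?T \<union> ?H)"
    proof -
      have "K v \<inter> (?T \<union> ?H) = {}" by (auto simp: K_def R_def)
      moreover have "finite (?T \<union> ?H)" using finR by simp
      ultimately show ?thesis using finK card_Un_disjoint split by metis
    qed
    then have sum: "card (K v) + card ?T + card ?H = n + m" using True TH by linarith
    \<comment> \<open>At most \<open>2m\<close> edges of \<open>R\<close> meet \<open>v\<close>.
      With at most one more tail than heads, twice the number of tails is at most
      \<open>2m + 1\<close>, so there are at most \<open>m\<close> tails.\<close>
    have "card (?T \<union> ?H) \<le> card {n..<n + m + m}"
    proof (rule card_inj_on_le)
      show "inj_on c (?T \<union> ?H)" by (rule inj_on_subset[OF inj[of v]]) (simp add: split)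
      show "c ` (?T \<union> ?H) \<subseteq> {n..<n + m + m}"
        using c by (auto simp: R_def proper_coloring_def)
    qed simp
    then have "card ?T \<le> m" using TH bal[rule_format, of v] by simp
    moreover have "card ({..<n} - c ` K v) = n - card (K v)"
    proof -
      have "inj_on c (K v)" by (rule inj_on_subset[OF inj[of v]]) (simp add: K_def)
      then show ?thesis
        using finK by (subst card_Diff_subset) (auto simp: card_image K_def)
    qed
    ultimately have "card ({..<n} - c ` K v) \<le> card ?H" using sum by linarith
    then show ?thesis using exists_function_covering[OF n, of "{..<n} - c ` K v" ?H] by blast
  qed (use n in \<open>auto intro!: exI[of _ "\<lambda>_. 0"]\<close>)
  then obtain g where g: "\<And>v. range (g v) \<subseteq> {..<n}"
    "\<And>v. card (incident_edges E ends v) = n + m \<Longrightarrow> {..<n} - c ` K v \<subseteq> g v ` {e \<in> R. h e = v}"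
    by metis
  \<comment> \<open>Each edge of \<open>R\<close> has one head, so the choices \<open>g v\<close>
    for different vertices do not conflict.\<close>
  define d where "d e = (if c e < n then c e else g (h e) e)" for e
  have "range d \<subseteq> {..<n}" using g(1) by (auto simp: d_def)
  moreover have "{..<n} \<subseteq> d ` incident_edges E ends v"
    if full: "card (incident_edges E ends v) = n + m" for v
  proof
    fix i assume i: "i \<in> {..<n}"
    show "i \<in> d ` incident_edges E ends v"
    proof (cases "i \<in> c ` K v")
      case True
      then show ?thesis by (auto simp: K_def d_def)
    next
      case False
      then obtain e where e: "e \<in> R" "h e = v" "i = g v e" using g(2)[OF full] i by blast
      then have "d e = i" "e \<in> incident_edges E ends v"
        using thR(1)[OF e(1)] by (auto simp: d_def R_def incident_edges_def)
      then show ?thesis by blast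
    qed
  qed
  ultimately show ?thesis by blast
qed

section \<open>Infinite multigraphs\<close>

text \<open>The family \<open>F\<close> selects finitely many edges at each vertex.  An edge is detached from each
  end that does not select it: there it gets a new end vertex \<open>Inr (e, u)\<close> of its own.\<close>

lemma gupta_selection_finite:
  assumes card2: "\<And>e. e \<in> E \<Longrightarrow> card (ends e) = 2" and n: "1 \<le> n" and m: "1 \<le> m"
    and Y: "finite Y"
    and F: "\<And>x. x \<in> Y \<Longrightarrow> F x \<subseteq> incident_edges E ends x"
    and cardF: "\<And>x. x \<in> Y \<Longrightarrow> card (F x) = n + m"
    and mult: "\<And>x y. x \<in> Y \<Longrightarrow> y \<in> Y \<Longrightarrow> x \<noteq> y \<Longrightarrow> card (F x \<inter> F y) \<le> m"
  shows "\<exists>c. range c \<subseteq> {..<n} \<and> (\<forall>x\<in>Y. {..<n} \<subseteq> c ` F x)"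
proof -
  define D where "D = \<Union>(F ` Y)"
  define split where "split e u = (if u \<in> Y \<and> e \<in> F u then Inl u else Inr (e, u))" for e u
  define ends' where "ends' e = split e ` ends e" for e
  have finF: "finite (F x)" if "x \<in> Y" for x
    using cardF[OF that] n by (intro card_ge_0_finite) simp
  have card2': "card (ends' e) = 2" if "e \<in> D" for e
  proof -
    have "inj_on (split e) (ends e)" by (auto simp: inj_on_def split_def split: if_splits)
    moreover have "e \<in> E" using that F by (auto simp: D_def incident_edges_def)
    ultimately show ?thesis using card2 by (simp add: ends'_def card_image)
  qed
  have Inl_iff: "Inl u \<in> ends' e \<longleftrightarrow> u \<in> Y \<and> e \<in> F u" for u e
    using F[of u] by (auto simp: ends'_def split_def incident_edges_def image_iff split: if_splits)
  have Inr_D: "f = e" if "Inr (e, u) \<in> ends' f" for e f u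
    using that by (auto simp: ends'_def split_def split: if_splits)
  have incInl: "incident_edges D ends' (Inl u) = (if u \<in> Y then F u else {})" for u
    using Inl_iff by (auto simp: incident_edges_def D_def)
  have deg: "card (incident_edges D ends' v) \<le> n + m" for v
  proof (cases v)
    case (Inl u)
    then show ?thesis using incInl cardF by simp
  next
    case (Inr q)
    then have "incident_edges D ends' v \<subseteq> {fst q}"
      using Inr_D by (cases q) (auto simp: incident_edges_def)
    then have "card (incident_edges D ends' v) \<le> 1"
      using card_mono[of "{fst q}"] by simp
    then show ?thesis using n by linarith
  qed
  have mult': "card {e \<in> D. ends' e = p} \<le> m" for p
  proof (cases "\<exists>f\<in>D. ends' f = p")
    case True
    then obtain v w where p: "p = {v, w}" "v \<noteq> w"
      using card2' card_2_iff[of p] by auto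
    show ?thesis
    proof (cases "\<exists>e u. Inr (e, u) \<in> p")
      case True
      then obtain e u where "Inr (e, u) \<in> p" by blast
      \<comment> \<open>A detached end belongs to a single edge, so such a class has at most one
        edge; this is where \<open>1 \<le> m\<close> enters.\<close>
      then have "{f \<in> D. ends' f = p} \<subseteq> {e}" using Inr_D by blast
      then have "card {f \<in> D. ends' f = p} \<le> 1"
        using card_mono[of "{e}"] by simp
      then show ?thesis using m by linarith
    next
      case False
      then obtain x y where xy: "v = Inl x" "w = Inl y"
        using p by (cases v; cases w) auto
      have inF: "x \<in> Y \<and> y \<in> Y \<and> f \<in> F x \<inter> F y" if "ends' f = p" for f
        using Inl_iff[of x f] Inl_iff[of y f] that p(1) xy by auto
      obtain f where "ends' f = p" using \<open>\<exists>f\<in>D. ends' f = p\<close> by blast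
      then have "x \<in> Y" "y \<in> Y" using inF by auto
      then have "card (F x \<inter> F y) \<le> m" "finite (F x \<inter> F y)"
        using mult[of x y] finF[of x] p(2) xy by auto
      moreover have "{f \<in> D. ends' f = p} \<subseteq> F x \<inter> F y" using inF by blast
      ultimately show ?thesis using card_mono le_trans by blast
    qed
  next
    case False
    then have "{e \<in> D. ends' e = p} = {}" by blast
    then show ?thesis by (simp only: card.empty)
  qed
  have "finite D" using Y finF by (simp add: D_def)
  then obtain c where "range c \<subseteq> {..<n}"
    "\<forall>v. card (incident_edges D ends' v) = n + m \<longrightarrow> {..<n} \<subseteq> c ` incident_edges D ends' v"
    using gupta_finite[OF _ card2' n deg mult'] by blast
  moreover have "incident_edges D ends' (Inl x) = F x" if "x \<in> Y" for x
    using incInl that by simp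
  ultimately have "\<forall>x\<in>Y. {..<n} \<subseteq> c ` F x" using cardF by metis
  with \<open>range c \<subseteq> {..<n}\<close> show ?thesis by blast
qed

text \<open>By Tychonoff the space of all maps into the finite discrete set of colors is compact.
  The demand at \<open>x\<close> concerns only the finitely many edges in \<open>F x\<close>, so it
  defines a closed set, and the finite intersection property applies.\<close>

lemma coloring_compactness:
  fixes F :: "'x \<Rightarrow> 'e set" and n :: nat
  assumes fin: "\<And>x. x \<in> X \<Longrightarrow> finite (F x)"
    and ex: "\<And>Y. finite Y \<Longrightarrow> Y \<subseteq> X \<Longrightarrow> \<exists>c. range c \<subseteq> {..<n} \<and> (\<forall>x\<in>Y. {..<n} \<subseteq> c ` F x)"
  shows "\<exists>c. range c \<subseteq> {..<n} \<and> (\<forall>x\<in>X. {..<n} \<subseteq> c ` F x)"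
proof -
  define T where "T = product_topology (\<lambda>_ :: 'e. discrete_topology {..<n}) UNIV"
  have top: "c \<in> topspace T \<longleftrightarrow> range c \<subseteq> {..<n}" for c
    by (auto simp: T_def)
  have "compact_space T"
    by (simp add: T_def compact_space_product_topology compact_space_discrete_topology)
  then have fip: "\<And>U. (\<forall>C\<in>U. closedin T C) \<Longrightarrow> (\<forall>G. finite G \<and> G \<subseteq> U \<longrightarrow> \<Inter>G \<noteq> {}) \<Longrightarrow> \<Inter>U \<noteq> {}"
    unfolding compact_space_fip by blast
  define G where "G x = {c \<in> topspace T. {..<n} \<subseteq> c ` F x}" for x
  have "closedin T {c \<in> topspace T. c e \<in> {i} \<inter> {..<n}}" for e i
  proof (rule closedin_continuous_map_preimage)
    show "continuous_map T (discrete_topology {..<n}) (\<lambda>c. c e)"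
      unfolding T_def by (rule continuous_map_product_projection) simp
  qed simp
  moreover have "{c \<in> topspace T. c e \<in> {i} \<inter> {..<n}} = {c \<in> topspace T. c e = i}" for e i
    unfolding top by auto
  ultimately have closed1: "closedin T {c \<in> topspace T. c e = i}" for e i by simp
  have closed: "closedin T (G x)" if "x \<in> X" for x
  proof -
    have "G x = topspace T \<inter> (\<Inter>i\<in>{..<n}. \<Union>e\<in>F x. {c \<in> topspace T. c e = i})"
      by (auto simp: G_def subset_iff image_iff)
    moreover have "closedin T (\<Union>e\<in>F x. {c \<in> topspace T. c e = i})" for i
      using fin[OF that] closed1 by (intro closedin_Union) auto
    ultimately show ?thesis
      \<comment> \<open>For \<open>n = 0\<close> the intersection over the colors has an empty index
        set, so \<open>closedin_Inter\<close> does not apply to it.\<close>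
      by (cases "n = 0") (auto intro!: closedin_Int closedin_Inter)
  qed
  \<comment> \<open>Adding \<open>topspace T\<close> keeps the common point inside the space even if
    \<open>X\<close> is empty.\<close>
  have "\<Inter>(insert (topspace T) (G ` X)) \<noteq> {}"
  proof (rule fip)
    show "\<forall>C\<in>insert (topspace T) (G ` X). closedin T C" using closed by auto
    show "\<forall>H. finite H \<and> H \<subseteq> insert (topspace T) (G ` X) \<longrightarrow> \<Inter>H \<noteq> {}"
    proof (intro allI impI)
      fix H assume H: "finite H \<and> H \<subseteq> insert (topspace T) (G ` X)"
      then have "finite (H - {topspace T})" "H - {topspace T} \<subseteq> G ` X" by auto
      then obtain Y where Y: "Y \<subseteq> X" "finite Y" "H - {topspace T} = G ` Y"
        by (meson finite_subset_image)
      then obtain c where "range c \<subseteq> {..<n}" "\<forall>x\<in>Y. {..<n} \<subseteq> c ` F x" using ex[OF Y(2,1)] by blast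
      then have "c \<in> C" if C: "C \<in> H" for C
      proof (cases "C = topspace T")
        case True
        then show ?thesis using top \<open>range c \<subseteq> {..<n}\<close> by simp
      next
        case False
        then obtain x where "x \<in> Y" "C = G x" using Y(3) C by blast
        then show ?thesis
          using top \<open>range c \<subseteq> {..<n}\<close> \<open>\<forall>x\<in>Y. {..<n} \<subseteq> c ` F x\<close> by (simp add: G_def)
      qed
      then show "\<Inter>H \<noteq> {}" by blast
    qed
  qed
  then obtain c where "c \<in> topspace T" "\<forall>x\<in>X. c \<in> G x" by blast
  then show ?thesis using top by (intro exI[of _ c]) (simp add: G_def)
qed

lemma gupta_selection:
  assumes "\<And>e. e \<in> E \<Longrightarrow> card (ends e) = 2" and "1 \<le> n" and "1 \<le> m"
    and "\<And>x. x \<in> X \<Longrightarrow> F x \<subseteq> incident_edges E ends x"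
    and "\<And>x. x \<in> X \<Longrightarrow> card (F x) = n + m"
    and "\<And>x y. x \<in> X \<Longrightarrow> y \<in> X \<Longrightarrow> x \<noteq> y \<Longrightarrow> card (F x \<inter> F y) \<le> m"
  shows "\<exists>c. range c \<subseteq> {..<n} \<and> (\<forall>x\<in>X. {..<n} \<subseteq> c ` F x)"
proof (rule coloring_compactness)
  show "finite (F x)" if "x \<in> X" for x
    using assms(2) assms(5)[OF that] by (intro card_ge_0_finite) simp
  show "\<exists>c. range c \<subseteq> {..<n} \<and> (\<forall>x\<in>Y. {..<n} \<subseteq> c ` F x)" if "finite Y" "Y \<subseteq> X" for Y
    using that assms by (intro gupta_selection_finite[of E ends n m Y F]) blast+
qed

section \<open>From selected edges to degrees and multiplicities\<close>

lemma edges_between_eq: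
  assumes "\<And>e. e \<in> E \<Longrightarrow> card (ends e) = 2" and "x \<noteq> y"
  shows "incident_edges E ends x \<inter> incident_edges E ends y = edges_between E ends x y"
proof -
  have "ends e = {x, y}" if "e \<in> E" "x \<in> ends e" "y \<in> ends e" for e
    using assms(1)[OF that(1)] that(2,3) assms(2) by (metis card_2_other insertE singletonD)
  then show ?thesis by (auto simp: incident_edges_def edges_between_def)
qed

text \<open>Select \<open>n + m\<close> edges at each vertex of \<open>X\<close>. Two selections
  share only edges joining their two vertices, so at most \<open>m\<close>.\<close>

lemma coloring_bounded_multiplicity:
  assumes card2: "\<And>e. e \<in> E \<Longrightarrow> card (ends e) = 2" and n: "1 \<le> n"
    and mult: "\<And>x y. x \<in> X \<Longrightarrow> x \<noteq> y \<Longrightarrow>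
      finite (edges_between E ends x y) \<and> card (edges_between E ends x y) \<le> m"
    and deg: "\<And>x. x \<in> X \<Longrightarrow> \<exists>F \<subseteq> incident_edges E ends x. card F = n + m"
  shows "\<exists>c. range c \<subseteq> {..<n} \<and> (\<forall>x\<in>X. {..<n} \<subseteq> c ` incident_edges E ends x)"
proof (cases "X = {}")
  case True
  then show ?thesis using n by (intro exI[of _ "\<lambda>_. 0"]) auto
next
  case False
  obtain F where F: "\<And>x. x \<in> X \<Longrightarrow> F x \<subseteq> incident_edges E ends x"
    "\<And>x. x \<in> X \<Longrightarrow> card (F x) = n + m"
    using deg by metis
  \<comment> \<open>An edge at a vertex of \<open>X\<close> exists since \<open>n + m > 0\<close>,
    and its own parallel class has at most \<open>m\<close> edges.\<close>
  have m: "1 \<le> m"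
  proof -
    from False obtain x where x: "x \<in> X" by blast
    then have "F x \<noteq> {}" using F(2)[of x] n by auto
    then obtain e where e: "e \<in> E" "x \<in> ends e"
      using F(1)[OF x] by (auto simp: incident_edges_def)
    then obtain y where y: "ends e = {x, y}" "x \<noteq> y" using card2 card_2_other by metis
    then have "e \<in> edges_between E ends x y" using e by (simp add: edges_between_def)
    then have "card (edges_between E ends x y) \<noteq> 0" using mult[OF x y(2)] by auto
    then show ?thesis using mult[OF x y(2)] by linarith
  qed
  have meet: "card (F x \<inter> F y) \<le> m" if "x \<in> X" "y \<in> X" "x \<noteq> y" for x y
  proof -
    have "F x \<inter> F y \<subseteq> edges_between E ends x y"
      using Int_mono[OF F(1)[OF that(1)] F(1)[OF that(2)]] edges_between_eq[of E ends x y, OF card2 that(3)]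
      by simp
    then show ?thesis using mult[OF that(1,3)] card_mono le_trans by blast
  qed
  obtain c where c: "range c \<subseteq> {..<n}" "\<forall>x\<in>X. {..<n} \<subseteq> c ` F x"
    using gupta_selection[of E ends n m X F, OF card2 n m F meet] by blast
  then have "{..<n} \<subseteq> c ` incident_edges E ends x" if "x \<in> X" for x
    using F(1)[OF that] that by blast
  with c(1) show ?thesis by blast
qed

text \<open>Parallel classes that are infinite take care of both of their ends by themselves.  A vertex
  that meets no such class has infinitely many neighbors, and there one edge for each neighbor is
  enough: this reduces the rest to simple graphs.\<close>

lemma coloring_infinite_degrees:
  fixes n :: nat
  assumes card2: "\<And>e. e \<in> E \<Longrightarrow> card (ends e) = 2" and n: "1 \<le> n"
    and deg: "\<And>x. x \<in> X \<Longrightarrow> infinite (incident_edges E ends x)"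
  shows "\<exists>c. range c \<subseteq> {..<n} \<and> (\<forall>x\<in>X. {..<n} \<subseteq> c ` incident_edges E ends x)"
proof -
  define P where "P p = {e \<in> E. ends e = p}" for p
  \<comment> \<open>\<open>X2\<close> collects the vertices of \<open>X\<close> on no infinite
    parallel class, and \<open>E2\<close> contains one chosen edge from each class.\<close>
  define X2 where "X2 = {x \<in> X. \<forall>p. x \<in> p \<longrightarrow> finite (P p)}"
  define E2 where "E2 = {e \<in> E. e = (SOME f. f \<in> P (ends e))}"
  have rep: "\<exists>f\<in>E2. ends f = ends e" if "e \<in> E" for e
  proof -
    let ?f = "SOME f. f \<in> P (ends e)"
    have "?f \<in> P (ends e)" using someI[of "\<lambda>f. f \<in> P (ends e)" e] that by (simp add: P_def)
    then show ?thesis by (intro bexI[of _ ?f]) (auto simp: P_def E2_def)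
  qed
  have E2_uniq: "e = f" if "e \<in> E2" "f \<in> E2" "ends e = ends f" for e f
    using that unfolding E2_def by auto
  have "infinite (incident_edges E2 ends x)" if x: "x \<in> X2" for x
  proof
    assume "finite (incident_edges E2 ends x)"
    \<comment> \<open>Finitely many representatives at \<open>x\<close>, each with a finite class,
      would leave only finitely many edges at \<open>x\<close>.\<close>
    then have "finite (\<Union>e\<in>incident_edges E2 ends x. P (ends e))"
      using x by (auto simp: X2_def incident_edges_def)
    moreover have "incident_edges E ends x \<subseteq> (\<Union>e\<in>incident_edges E2 ends x. P (ends e))"
    proof
      fix e assume e: "e \<in> incident_edges E ends x"
      then obtain f where "f \<in> E2" "ends f = ends e"
        using rep[of e] by (auto simp: incident_edges_def)
      then show "e \<in> (\<Union>e\<in>incident_edges E2 ends x. P (ends e))"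
        using e by (auto simp: incident_edges_def P_def)
    qed
    ultimately show False using deg[of x] x finite_subset by (auto simp: X2_def)
  qed
  then have "\<exists>F \<subseteq> incident_edges E2 ends x. card F = n + 1" if "x \<in> X2" for x
    using infinite_arbitrarily_large[of "incident_edges E2 ends x" "n + 1"] that by blast
  moreover have "finite (edges_between E2 ends x y) \<and> card (edges_between E2 ends x y) \<le> 1" for x y
  proof (cases "edges_between E2 ends x y = {}")
    case False
    then obtain e where "e \<in> edges_between E2 ends x y" by blast
    then have "edges_between E2 ends x y = {e}"
      using E2_uniq by (auto simp: edges_between_def)
    then show ?thesis by simp
  qed simp
  ultimately obtain c2 where c2: "range c2 \<subseteq> {..<n}"
    "\<forall>x\<in>X2. {..<n} \<subseteq> c2 ` incident_edges E2 ends x"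
    using coloring_bounded_multiplicity[of E2 ends n X2 1] card2 n unfolding E2_def by blast
  have "\<exists>g. range g \<subseteq> {..<n} \<and> (infinite (P p) \<longrightarrow> {..<n} \<subseteq> g ` P p)" for p
    using exists_function_covering[OF n order_refl, of "P p"] c2(1) by (cases "finite (P p)") blast+
  then obtain g where g: "\<And>p. range (g p) \<subseteq> {..<n}"
    "\<And>p. infinite (P p) \<Longrightarrow> {..<n} \<subseteq> g p ` P p"
    by metis
  \<comment> \<open>The two recipes do not interfere: edges at vertices of \<open>X2\<close> lie in
    finite classes and keep their color from \<open>c2\<close>.\<close>
  define c where "c e = (if infinite (P (ends e)) then g (ends e) e else c2 e)" for e
  have "range c \<subseteq> {..<n}" using g(1) c2(1) unfolding c_def by fastforce
  moreover have "{..<n} \<subseteq> c ` incident_edges E ends x" if x: "x \<in> X" for x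
  proof (cases "x \<in> X2")
    case True
    then have "c e = c2 e" if "e \<in> incident_edges E2 ends x" for e
      using that by (auto simp: c_def X2_def incident_edges_def)
    then have "c2 ` incident_edges E2 ends x \<subseteq> c ` incident_edges E ends x"
      by (auto simp: E2_def incident_edges_def intro!: image_eqI)
    then show ?thesis using c2(2) True by blast
  next
    case False
    then obtain p where p: "x \<in> p" "infinite (P p)" using x by (auto simp: X2_def)
    then have "g p ` P p \<subseteq> c ` incident_edges E ends x"
      by (auto simp: P_def c_def incident_edges_def intro!: image_eqI)
    then show ?thesis using g(2)[OF p(2)] by blast
  qed
  ultimately show ?thesis by blast
qed

theorem theorem4p6:
  fixes V :: "'v set" and E :: "'e set" and ends :: "'e \<Rightarrow> 'v set"
    and X :: "'v set" and n :: nat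
  assumes "1 \<le> n"
    and "multigraph V E ends"
    and "X \<subseteq> V"
    and "\<And>x. x \<in> X \<Longrightarrow> |{..<n}| +c sup_multiplicity V E ends \<le>o vertex_degree E ends x"
  shows "\<exists>c. good_coloring E ends n X c"
proof -
  interpret multigraph V E ends by (rule assms(2))
  define s where "s = sup_multiplicity V E ends"
  \<comment> \<open>A concrete set of cardinality \<open>s\<close>, so that the cardinal
    inequalities become injections.\<close>
  define S where "S = Field s"
  have s: "Card_order s" "\<And>u v. u \<in> V \<Longrightarrow> v \<in> V \<Longrightarrow> |edges_between E ends u v| \<le>o s"
    using is_card_Sup_card_Sup[of "{edges_between E ends u v | u v. u \<in> V \<and> v \<in> V}"]
    unfolding s_def sup_multiplicity_def is_card_Sup_def by blast+
  have between: "|edges_between E ends u v| \<le>o |S|" if "u \<in> V" for u v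
  proof (cases "v \<in> V")
    case True
    then show ?thesis
      using s(2)[OF that] ordIso_symmetric[OF card_of_Field_ordIso[OF s(1)]] ordLeq_ordIso_trans
      unfolding S_def by blast
  next
    case False
    then have "edges_between E ends u v = {}"
      using ends_subset by (auto simp: edges_between_def)
    then show ?thesis by (simp add: card_of_empty)
  qed
  have deg: "|{..<n} <+> S| \<le>o |incident_edges E ends x|" if "x \<in> X" for x
    using assms(4)[OF that] unfolding csum_def vertex_degree_def s_def S_def Field_card_of .
  have "\<exists>c. range c \<subseteq> {..<n} \<and> (\<forall>x\<in>X. {..<n} \<subseteq> c ` incident_edges E ends x)"
  proof (cases "finite S")
    case True
    show ?thesis
    proof (rule coloring_bounded_multiplicity[OF card_ends assms(1)])
      fix x assume x: "x \<in> X"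
      obtain f where f: "inj_on f ({..<n} <+> S)" "f ` ({..<n} <+> S) \<subseteq> incident_edges E ends x"
        using deg[OF x] card_of_ordLeq by metis
      then show "\<exists>F \<subseteq> incident_edges E ends x. card F = n + card S"
        using True by (intro exI[of _ "f ` ({..<n} <+> S)"]) (simp add: card_image card_Plus)
      fix y
      have "|edges_between E ends x y| \<le>o |S|" using between x assms(3) by blast
      then obtain g where "inj_on g (edges_between E ends x y)" "g ` edges_between E ends x y \<subseteq> S"
        using card_of_ordLeq by metis
      then show "finite (edges_between E ends x y) \<and> card (edges_between E ends x y) \<le> card S"
        using True by (metis card_inj_on_le inj_on_finite)
    qed
  next
    case False
    \<comment> \<open>The degree condition embeds the infinite set \<open>S\<close> into the edges
      at \<open>x\<close>.\<close>
    then have "infinite (incident_edges E ends x)" if "x \<in> X" for x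
      using card_of_ordLeq_finite[OF deg[OF that]] False by auto
    then show ?thesis by (intro coloring_infinite_degrees[of E ends n X] card_ends assms(1))
  qed
  then show ?thesis unfolding good_coloring_def by blast
qed

end
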